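(* Let $p$ be a prime and let $A$ be an $n\times m$ random matrix over $\mathbb{Z}/p\mathbb{Z}$ with $m\ge n$, having min-entropy at least $\beta$ for some $\beta>0$. Then \[\mathbb{P}(\operatorname{rank}(A)=n)\ \ge\ 1-\frac{1}{\beta^2}(1-\beta)^{m+1-n}.\] In particular, there is a constant $K>0$ depending only on $\beta$ such that $\mathbb{P}(\operatorname{rank}(A)=n)\ge 1-e^{-K(m-n)}$.
   Context: Let $A$ be a random matrix over $\mathbb{Z}/p\mathbb{Z}$, $\beta>0$, and $I$ a set of entries of $A$. An entry $A_{i_0j_0}$ has min-entropy at least $\beta$ with respect to $I$ if for every choice of values $a_{ij}$ for the entries in $I$ that occurs with nonzero probability, and every $a\in\mathbb{Z}/p\mathbb{Z}$, one has $\mathbb{P}(A_{i_0j_0}=a\mid A_{ij}=a_{ij}\ \forall (i,j)\in I)\le 1-\beta$. The matrix $A$ has min-entropy at least $\beta$ if every entry of $A$ has min-entropy at least $\beta$ with respect to the set of all other entries. *)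

theory Defs
  imports
    "HOL-Probability.Probability"
    "HOL-Number_Theory.Residues"
    "Jordan_Normal_Form.Matrix"
    "Jordan_Normal_Form.Missing_VectorSpace"
begin

text \<open>
  The prime \<open>p\<close> and the dimensions have to be quantified inside formulas, so matrices over
  \<open>\<int>/p\<int>\<close> are integer matrices with entries in the carrier of \<^term>\<open>residue_ring (int p)\<close>,
  i.e. in \<open>{0..p-1}\<close>, and linear algebra is done over that ring rather than over a field type.
\<close>

definition mats_over :: "('a, 'b) ring_scheme \<Rightarrow> nat \<Rightarrow> nat \<Rightarrow> 'a mat set" where
  "mats_over R n m = {X \<in> carrier_mat n m. elements_mat X \<subseteq> carrier R}"

definition mat_column :: "'a mat \<Rightarrow> nat \<Rightarrow> nat \<Rightarrow> 'a" where
  "mat_column X j = (\<lambda>i\<in>{..<dim_row X}. X $$ (i, j))"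

text \<open>
  The dimension of the column space inside \<open>R\<^sup>n\<close>; this is \<open>vec_space.rank\<close> with the field
  given as a ring record instead of a type.
\<close>

definition rank_over :: "('a, 'b) ring_scheme \<Rightarrow> 'a mat \<Rightarrow> nat" where
  "rank_over R X =
    (let V = ring.func_space R {..<dim_row X}
     in vectorspace.dim R
          (V\<lparr>carrier := LinearCombinations.module.span R V (mat_column X ` {..<dim_col X})\<rparr>))"

text \<open>
  A random matrix over \<open>\<int>/p\<int>\<close> takes finitely many values and is given by its distribution.
\<close>

definition random_matrix :: "nat \<Rightarrow> nat \<Rightarrow> nat \<Rightarrow> int mat pmf \<Rightarrow> bool" where
  "random_matrix p n m A \<longleftrightarrow> set_pmf A \<subseteq> mats_over (residue_ring (int p)) n m"

definition entry_min_entropy_ge ::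
  "nat \<Rightarrow> int mat pmf \<Rightarrow> real \<Rightarrow> (nat \<times> nat) set \<Rightarrow> nat \<times> nat \<Rightarrow> bool" where
  "entry_min_entropy_ge p A \<beta> I e \<longleftrightarrow>
    (\<forall>a \<in> I \<rightarrow> carrier (residue_ring (int p)).
       \<P>(X in A. \<forall>ij\<in>I. X $$ ij = a ij) \<noteq> 0 \<longrightarrow>
       (\<forall>c \<in> carrier (residue_ring (int p)).
          \<P>(X in A. X $$ e = c \<bar> \<forall>ij\<in>I. X $$ ij = a ij) \<le> 1 - \<beta>))"

definition min_entropy_ge :: "nat \<Rightarrow> nat \<Rightarrow> nat \<Rightarrow> int mat pmf \<Rightarrow> real \<Rightarrow> bool" where
  "min_entropy_ge p n m A \<beta> \<longleftrightarrow>
    (\<forall>e \<in> {..<n} \<times> {..<m}. entry_min_entropy_ge p A \<beta> ({..<n} \<times> {..<m} - {e}) e)"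

end

theory Submission
  imports Defs
begin

text \<open>
  Write \<open>q = 1 - \<beta>\<close> and reveal the rows one after another. The first \<open>k\<close> rows have at most \<open>k\<close>
  pivot columns, and a vector in their span is determined by its pivot entries. Hence, if row \<open>k\<close>
  (counting from 0) lies in this span, its other \<open>\<ge> m - k\<close> entries are all determined by the rest
  of the matrix, which has conditional probability at most \<open>q\<^bsup>m-k\<^esup>\<close>. So the rows are independent with
  probability at least \<open>\<Prod>\<^bsub>k<n\<^esub> (1 - q\<^bsup>m-k\<^esup>)\<close>. This is at least \<open>1 - q\<^bsup>m+1-n\<^esup>/\<beta>\<close>, which is even
  stronger than the first bound, and it is also bounded below by a positive constant depending only
  on \<open>\<beta>\<close>. The latter is needed for the exponential bound when \<open>m - n\<close> is small.
\<close>

section \<open>Elimination modulo a prime\<close>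

text \<open>Independence mod \<open>p\<close> is phrased by divisibility of integer combinations.
  Elimination can then work with arbitrary integers, without reducing entries to the carrier after
  each row operation.\<close>

definition rows_indep :: "int \<Rightarrow> nat \<Rightarrow> nat \<Rightarrow> (nat \<Rightarrow> nat \<Rightarrow> int) \<Rightarrow> bool" where
  "rows_indep p k m x \<longleftrightarrow>
    (\<forall>c. (\<forall>j<m. p dvd (\<Sum>i<k. c i * x i j)) \<longrightarrow> (\<forall>i<k. p dvd c i))"

lemma prime_int_inverse:
  fixes p a :: int
  assumes "prime p" "\<not> p dvd a"
  obtains u where "p dvd u * a - 1"
proof -
  have "coprime a p"
    using assms prime_imp_coprime coprime_commute by blast
  then obtain u where "[a * u = 1] (mod p)"
    using cong_solve_coprime_int by blast
  then show ?thesis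
    using that[of u] by (simp add: cong_iff_dvd_diff mult.commute)
qed

lemma sum_eliminate_column:
  fixes c :: "'i \<Rightarrow> 'a::comm_ring"
  shows "(\<Sum>i\<in>I. c i * (x i j - u * x i j0 * y j)) =
    (\<Sum>i\<in>I. c i * x i j) - u * (\<Sum>i\<in>I. c i * x i j0) * y j"
  by (simp add: algebra_simps sum_subtractf sum_distrib_left)

text \<open>A vector in the row span is thus determined mod \<open>p\<close> by its entries in
  \<open>J\<close>. Induction on the number of rows: a last row that vanishes mod \<open>p\<close>
  contributes nothing; otherwise a column \<open>j0\<close> where it is nonzero is cleared from the
  other rows and added to their pivot set.\<close>

lemma pivot_columns:
  fixes x :: "nat \<Rightarrow> nat \<Rightarrow> int"
  assumes "prime p"
  shows "\<exists>J\<subseteq>{..<m}. card J \<le> k \<and>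
    (\<forall>c. (\<forall>j\<in>J. p dvd (\<Sum>i<k. c i * x i j)) \<longrightarrow> (\<forall>j<m. p dvd (\<Sum>i<k. c i * x i j)))"
proof (induction k arbitrary: x)
  case 0
  show ?case by (intro exI[of _ "{}"]) auto
next
  case (Suc k)
  show ?case
  proof (cases "\<forall>j<m. p dvd x k j")
    case True
    obtain J where J: "J \<subseteq> {..<m}" "card J \<le> k"
      "\<And>c. (\<forall>j\<in>J. p dvd (\<Sum>i<k. c i * x i j)) \<Longrightarrow> (\<forall>j<m. p dvd (\<Sum>i<k. c i * x i j))"
      using Suc.IH[of x] by blast
    have "p dvd (\<Sum>i<Suc k. c i * x i j) \<longleftrightarrow> p dvd (\<Sum>i<k. c i * x i j)" if "j < m" for c j
      using True that by (simp add: dvd_add_left_iff)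
    then have "\<forall>j<m. p dvd (\<Sum>i<Suc k. c i * x i j)"
      if "\<forall>j\<in>J. p dvd (\<Sum>i<Suc k. c i * x i j)" for c
      using that J(1) J(3)[of c] by (meson lessThan_iff subsetD)
    then show ?thesis
      using J(1,2) le_SucI by blast
  next
    case False
    then obtain j0 where j0: "j0 < m" "\<not> p dvd x k j0" by blast
    then obtain u where u: "p dvd u * x k j0 - 1"
      using assms prime_int_inverse by blast
    define x' where "x' i j = x i j - u * x i j0 * x k j" for i j
    obtain J where J: "J \<subseteq> {..<m}" "card J \<le> k"
      "\<And>c. (\<forall>j\<in>J. p dvd (\<Sum>i<k. c i * x' i j)) \<Longrightarrow> (\<forall>j<m. p dvd (\<Sum>i<k. c i * x' i j))"
      using Suc.IH[of x'] by blast
    have fin: "finite J" using J(1) finite_subset by blast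
    \<comment> \<open>Vanishing in column \<open>j0\<close> forces \<open>c k\<close> to be
      \<open>- u * ?s j0\<close> mod \<open>p\<close>. With this coefficient, adding the last row
      has exactly the effect of clearing column \<open>j0\<close>.\<close>
    have key: "p dvd (\<Sum>i<Suc k. c i * x i j) \<longleftrightarrow> p dvd (\<Sum>i<k. c i * x' i j)"
      if "p dvd (\<Sum>i<Suc k. c i * x i j0)" for c j
    proof -
      let ?s = "\<lambda>j. \<Sum>i<k. c i * x i j"
      have "c k + u * ?s j0 = u * (\<Sum>i<Suc k. c i * x i j0) - c k * (u * x k j0 - 1)"
        by (simp add: algebra_simps)
      then have *: "p dvd c k + u * ?s j0"
        using dvd_diff[OF dvd_mult[OF that, of u] dvd_mult[OF u, of "c k"]] by simp
      have "(\<Sum>i<Suc k. c i * x i j) = (\<Sum>i<k. c i * x' i j) + (c k + u * ?s j0) * x k j"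
        unfolding x'_def sum_eliminate_column by (simp add: algebra_simps)
      then show ?thesis
        using * by (simp add: dvd_add_left_iff del: sum.lessThan_Suc)
    qed
    show ?thesis
    proof (intro exI[of _ "insert j0 J"] conjI allI impI)
      show "insert j0 J \<subseteq> {..<m}" using J(1) j0 by auto
      show "card (insert j0 J) \<le> Suc k" using J(2) fin by (simp add: card_insert_if)
      fix c j assume "\<forall>j\<in>insert j0 J. p dvd (\<Sum>i<Suc k. c i * x i j)" and "j < m"
      then show "p dvd (\<Sum>i<Suc k. c i * x i j)"
        using key[of c] J(3)[of c] by (meson insertI1 insertI2)
    qed
  qed
qed

text \<open>This is the part of "row rank equals column rank" that is needed: independent rows make
  the columns span everything. Gaussian elimination with the last row as pivot row, by induction on
  \<open>k\<close>.\<close>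

lemma rows_indep_imp_solvable:
  fixes x :: "nat \<Rightarrow> nat \<Rightarrow> int"
  assumes "prime p" "rows_indep p k m x"
  shows "\<exists>d. \<forall>i<k. [(\<Sum>j<m. d j * x i j) = y i] (mod p)"
  using assms(2)
proof (induction k arbitrary: x y)
  case 0
  show ?case by simp
next
  case (Suc k)
  have "\<exists>j<m. \<not> p dvd x k j"
  proof (rule ccontr)
    assume "\<not> ?thesis"
    then have "\<forall>i<Suc k. p dvd (if i = k then 1 else 0)"
      using Suc.prems unfolding rows_indep_def
      by (elim allE[of _ "\<lambda>i. if i = k then 1 else 0"]) auto
    then have "p dvd 1" by (metis lessI)
    then show False using assms(1) by (simp add: not_prime_unit)
  qed
  then obtain j0 where j0: "j0 < m" "\<not> p dvd x k j0" by blast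
  then obtain u where u: "p dvd u * x k j0 - 1"
    using assms prime_int_inverse by blast
  define x' where "x' i j = x i j - u * x i j0 * x k j" for i j
  have "rows_indep p k m x'"
    unfolding rows_indep_def
  proof (intro allI impI)
    fix c i assume c: "\<forall>j<m. p dvd (\<Sum>i<k. c i * x' i j)" and "i < k"
    \<comment> \<open>A relation among the cleared rows becomes one among the original rows once the
      multiples of row \<open>k\<close> that were subtracted are collected in its
      coefficient.\<close>
    define c' where "c' = c(k := - u * (\<Sum>i<k. c i * x i j0))"
    have "(\<Sum>i<Suc k. c' i * x i j) = (\<Sum>i<k. c i * x' i j)" for j
      unfolding x'_def sum_eliminate_column by (simp add: c'_def)
    then have "\<forall>i<Suc k. p dvd c' i"
      using c Suc.prems[unfolded rows_indep_def, rule_format, of c'] by simp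
    then have "p dvd c' i"
      using \<open>i < k\<close> less_SucI by blast
    then show "p dvd c i"
      using \<open>i < k\<close> by (simp add: c'_def)
  qed
  then obtain d where d: "\<And>i. i < k \<Longrightarrow> [(\<Sum>j<m. d j * x' i j) = y i - u * x i j0 * y k] (mod p)"
    using Suc.IH[of x' "\<lambda>i. y i - u * x i j0 * y k"] by blast
  define r where "r i = (\<Sum>j<m. d j * x i j)" for i
  \<comment> \<open>Column \<open>j0\<close> of \<open>x'\<close> is zero mod \<open>p\<close>, so
    the coefficient at \<open>j0\<close> is still free; \<open>t\<close> corrects it so that
    equation \<open>k\<close> holds as well.\<close>
  define t where "t = u * (y k - r k)"
  have upd: "(\<Sum>j<m. (d(j0 := d j0 + t)) j * x i j) = r i + t * x i j0" for i
  proof -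
    have "(\<Sum>j<m. (d(j0 := d j0 + t)) j * x i j)
        = (\<Sum>j<m. d j * x i j + (if j = j0 then t * x i j else 0))"
      by (intro sum.cong) (auto simp: algebra_simps)
    also have "\<dots> = r i + t * x i j0"
      using j0 by (simp add: sum.distrib r_def)
    finally show ?thesis .
  qed
  show ?case
  proof (intro exI allI impI)
    fix i assume i: "i < Suc k"
    show "[(\<Sum>j<m. (d(j0 := d j0 + t)) j * x i j) = y i] (mod p)"
    proof (cases "i = k")
      case True
      have "r k + t * x k j0 - y k = (y k - r k) * (u * x k j0 - 1)"
        by (simp add: t_def algebra_simps)
      then show ?thesis
        using u True unfolding upd cong_iff_dvd_diff by simp
    next
      case False
      have "(\<Sum>j<m. d j * x' i j) = r i - u * x i j0 * r k"
        unfolding x'_def r_def by (simp add: algebra_simps sum_subtractf sum_distrib_left)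
      then have "[r i - u * x i j0 * r k = y i - u * x i j0 * y k] (mod p)"
        using d[of i] False i by simp
      then show ?thesis
        unfolding upd unfolding cong_iff_dvd_diff t_def by (simp add: algebra_simps)
    qed
  qed
qed

text \<open>In a nontrivial relation the coefficient of row \<open>k\<close> cannot vanish mod
  \<open>p\<close>, since the earlier rows are independent; dividing by it expresses row
  \<open>k\<close> through them.\<close>

lemma row_in_span_if_not_indep:
  fixes x :: "nat \<Rightarrow> nat \<Rightarrow> int"
  assumes "prime p" "rows_indep p k m x" "\<not> rows_indep p (Suc k) m x"
  shows "\<exists>c. \<forall>j<m. [x k j = (\<Sum>i<k. c i * x i j)] (mod p)"
proof -
  obtain c i where c: "\<And>j. j < m \<Longrightarrow> p dvd (\<Sum>i<Suc k. c i * x i j)" and i: "i < Suc k" "\<not> p dvd c i"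
    using assms(3) unfolding rows_indep_def by blast
  have "\<not> p dvd c k"
  proof
    assume ck: "p dvd c k"
    then have "\<forall>j<m. p dvd (\<Sum>i<k. c i * x i j)"
      using c by (simp add: dvd_add_left_iff)
    then have "\<forall>i<k. p dvd c i"
      using assms(2) unfolding rows_indep_def by blast
    with ck i show False by (auto simp: less_Suc_eq)
  qed
  then obtain u where u: "p dvd u * c k - 1"
    using assms(1) prime_int_inverse by blast
  have "[x k j = (\<Sum>i<k. (- u * c i) * x i j)] (mod p)" if "j < m" for j
  proof -
    have "x k j - (\<Sum>i<k. (- u * c i) * x i j) = u * (\<Sum>i<Suc k. c i * x i j) - (u * c k - 1) * x k j"
      by (simp add: algebra_simps sum_distrib_left sum_negf)
    then show ?thesis
      using dvd_diff[OF dvd_mult[OF c[OF that], of u] dvd_mult2[OF u, of "x k j"]]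
      unfolding cong_iff_dvd_diff by simp
  qed
  then show ?thesis
    by (intro exI[of _ "\<lambda>i. - u * c i"]) simp
qed

section \<open>The rank of a matrix with independent rows\<close>

lemma (in field) vectorspace_func_space: "vectorspace R (func_space S)"
  using func_space_is_module[of S] field_axioms by (simp add: vectorspace_def)

text \<open>The unit vectors \<open>e i\<close> form a basis.\<close>

lemma (in field) dim_func_space:
  assumes "finite S"
  shows "vectorspace.dim R (func_space S) = card S"
proof -
  let ?V = "func_space S"
  interpret V: vectorspace R ?V
    by (rule vectorspace_func_space)
  define e where "e i = (\<lambda>j\<in>S. if j = i then \<one> else \<zero>)" for i
  have e_carrier: "e i \<in> carrier ?V" for i
    by (auto simp: e_def func_space_def)
  have inj: "inj_on e S"
  proof (rule inj_onI)
    fix i j assume "i \<in> S" "j \<in> S" "e i = e j"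
    then have "e i i = e j i" by simp
    with \<open>i \<in> S\<close> show "i = j" by (auto simp: e_def split: if_splits)
  qed
  have sum_e: "finsum ?V (\<lambda>i. c i \<odot>\<^bsub>?V\<^esub> e i) T = (\<lambda>j\<in>S. if j \<in> T then c j else \<zero>)"
    if "T \<subseteq> S" and c: "c \<in> S \<rightarrow> carrier R" for T c
    using finite_subset[OF that(1) assms] that(1)
  proof (induction T rule: finite_induct)
    case empty
    then show ?case unfolding V.finsum_empty by (simp add: func_space_def)
  next
    case (insert i T)
    have "(\<lambda>i. c i \<odot>\<^bsub>?V\<^esub> e i) \<in> T \<rightarrow> carrier ?V" "c i \<odot>\<^bsub>?V\<^esub> e i \<in> carrier ?V"
      using insert.prems c e_carrier by (auto intro!: V.smult_closed)
    then have "finsum ?V (\<lambda>i. c i \<odot>\<^bsub>?V\<^esub> e i) (insert i T)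
        = c i \<odot>\<^bsub>?V\<^esub> e i \<oplus>\<^bsub>?V\<^esub> (\<lambda>j\<in>S. if j \<in> T then c j else \<zero>)"
      using insert by (subst V.finsum_insert) (auto simp: restrict_def)
    also have "\<dots> = (\<lambda>j\<in>S. if j \<in> insert i T then c j else \<zero>)"
      using insert.hyps insert.prems c
      by (auto simp: func_space_def e_def restrict_def fun_eq_iff Pi_iff)
    finally show ?case .
  qed
  have lincomb_e: "V.lincomb a (e ` S) = (\<lambda>j\<in>S. a (e j))" if a: "a \<in> e ` S \<rightarrow> carrier R" for a
  proof -
    have "V.lincomb a (e ` S) = finsum ?V (\<lambda>i. a (e i) \<odot>\<^bsub>?V\<^esub> e i) S"
      unfolding V.lincomb_def
      using a e_carrier inj by (subst V.finsum_reindex) (auto intro!: V.smult_closed)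
    also have "\<dots> = (\<lambda>j\<in>S. a (e j))"
      using a by (subst sum_e) (auto simp: restrict_def)
    finally show ?thesis .
  qed
  have e_sub: "e ` S \<subseteq> carrier ?V"
    using e_carrier by blast
  have "V.basis (e ` S)"
    unfolding V.basis_def
  proof (intro conjI)
    show "V.lin_indpt (e ` S)"
    proof (rule V.finite_lin_indpt2)
      fix a assume a: "a \<in> e ` S \<rightarrow> carrier R" "V.lincomb a (e ` S) = \<zero>\<^bsub>?V\<^esub>"
      have "a (e j) = \<zero>" if "j \<in> S" for j
        using fun_cong[OF a(2)[unfolded lincomb_e[OF a(1)]], of j] that
        by (simp add: func_space_def)
      then show "\<forall>v\<in>e ` S. a v = \<zero>" by blast
    qed (use assms e_sub in auto)
    have "v \<in> V.span (e ` S)" if v: "v \<in> carrier ?V" for v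
    proof -
      \<comment> \<open>Coefficients in \<open>V.lincomb\<close> are indexed by vectors, so the
        coordinate of \<open>v\<close> belonging to \<open>e i\<close> is found through the inverse
        of \<open>e\<close>.\<close>
      define a where "a u = v (the_inv_into S e u)" for u
      have a_e: "a (e j) = v j" if "j \<in> S" for j
        using that by (simp add: a_def the_inv_into_f_f[OF inj])
      have a: "a \<in> e ` S \<rightarrow> carrier R"
        using v by (auto simp: a_e func_space_def)
      have "(\<lambda>j\<in>S. a (e j)) = v"
        using v by (auto simp: a_e func_space_def restrict_def fun_eq_iff PiE_def extensional_def)
      then have "V.lincomb a (e ` S) = v"
        using lincomb_e[OF a] by simp
      with a assms show ?thesis
        by (auto simp: V.finite_span[OF _ e_sub])
    qed
    then show "V.span (e ` S) = carrier ?V"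
      using V.span_is_subset2[OF e_sub] by blast
  qed (rule e_sub)
  then show ?thesis
    using V.dim_basis[of "e ` S"] assms by (simp add: card_image[OF inj])
qed

lemma mats_over_entry:
  assumes "X \<in> mats_over R n m" "ij \<in> {..<n} \<times> {..<m}"
  shows "X $$ ij \<in> carrier R"
  using assms unfolding mats_over_def elements_mat_def by fastforce

text \<open>Solvability for every right-hand side says that the column span is the whole space,
  whose dimension is \<open>n\<close>.\<close>

lemma rank_over_eq_if_rows_indep:
  fixes X :: "int mat"
  assumes p: "prime p" and X: "X \<in> mats_over (residue_ring (int p)) n m"
    and ind: "rows_indep (int p) n m (\<lambda>i j. X $$ (i, j))"
  shows "rank_over (residue_ring (int p)) X = n"
proof -
  define R where "R = residue_ring (int p)"
  interpret residues_prime p R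
    by (unfold_locales) (use p R_def in auto)
  have carrier_R: "carrier R = {0..<int p}"
    by (auto simp: R_def residue_ring_def)
  have p0: "int p > 0"
    using p prime_gt_0_nat by simp
  have dims: "dim_row X = n" "dim_col X = m"
    using X by (auto simp: mats_over_def)
  have entries: "X $$ (i, j) \<in> carrier R" if "i < n" "j < m" for i j
    using mats_over_entry[OF X, of "(i, j)"] that by (simp add: R_def)
  let ?V = "func_space {..<n}"
  let ?C = "mat_column X ` {..<m}"
  interpret V: vectorspace R ?V
    by (rule vectorspace_func_space)
  have C: "?C \<subseteq> carrier ?V"
    using entries dims by (auto simp: mat_column_def func_space_def split: if_splits)
  interpret span: submodule R "V.span ?C" ?V
    using C by (rule V.span_is_submodule)
  have R_ops: "\<zero>\<^bsub>R\<^esub> = 0" "\<And>a b. a \<oplus>\<^bsub>R\<^esub> b = (a + b) mod int p" "\<And>a b. a \<otimes>\<^bsub>R\<^esub> b = a * b mod int p"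
    by (simp_all add: R_def residue_ring_def)
  have V_ops: "\<zero>\<^bsub>?V\<^esub> = (\<lambda>i\<in>{..<n}. 0)"
    "\<And>f g. f \<oplus>\<^bsub>?V\<^esub> g = (\<lambda>i\<in>{..<n}. (f i + g i) mod int p)"
    "\<And>c f. c \<odot>\<^bsub>?V\<^esub> f = (\<lambda>i\<in>{..<n}. (c * f i) mod int p)"
    unfolding func_space_def by (simp_all add: R_ops)
  \<comment> \<open>Different indices may give equal columns. The combination is therefore built up
    by closure of the span instead of as a linear combination over the set of columns.\<close>
  have comb: "(\<lambda>i\<in>{..<n}. (\<Sum>j\<in>J. d j * X $$ (i, j)) mod int p) \<in> V.span ?C"
    if "finite J" "J \<subseteq> {..<m}" for d J
    using that
  proof (induction J rule: finite_induct)
    case empty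
    then show ?case
      using span.zero_closed by (simp add: V_ops restrict_def)
  next
    case (insert j J)
    have "mat_column X j \<in> V.span ?C"
      using insert.prems V.in_own_span[OF C] by blast
    then have "(d j mod int p) \<odot>\<^bsub>?V\<^esub> mat_column X j \<oplus>\<^bsub>?V\<^esub>
        (\<lambda>i\<in>{..<n}. (\<Sum>j\<in>J. d j * X $$ (i, j)) mod int p) \<in> V.span ?C"
      using insert p0 by (intro span.m_closed span.smult_closed) (auto simp: carrier_R restrict_def)
    also have "(d j mod int p) \<odot>\<^bsub>?V\<^esub> mat_column X j \<oplus>\<^bsub>?V\<^esub>
        (\<lambda>i\<in>{..<n}. (\<Sum>j\<in>J. d j * X $$ (i, j)) mod int p)
        = (\<lambda>i\<in>{..<n}. (\<Sum>j\<in>insert j J. d j * X $$ (i, j)) mod int p)"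
      using insert.hyps
      by (auto simp: V_ops mat_column_def dims restrict_def fun_eq_iff mod_simps)
    finally show ?case .
  qed
  have "v \<in> V.span ?C" if v: "v \<in> carrier ?V" for v
  proof -
    obtain d where d: "\<And>i. i < n \<Longrightarrow> [(\<Sum>j<m. d j * X $$ (i, j)) = v i] (mod int p)"
      using rows_indep_imp_solvable[OF _ ind, of v] p by auto
    have "v = (\<lambda>i\<in>{..<n}. (\<Sum>j<m. d j * X $$ (i, j)) mod int p)"
    proof
      fix i
      show "v i = (\<lambda>i\<in>{..<n}. (\<Sum>j<m. d j * X $$ (i, j)) mod int p) i"
      proof (cases "i < n")
        case True
        then have "v i mod int p = v i"
          using v by (auto simp: func_space_def carrier_R PiE_iff)
        then show ?thesis
          using d[OF True] True by (simp add: cong_def)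
      next
        case False
        then show ?thesis
          using v by (auto simp: func_space_def PiE_def extensional_def)
      qed
    qed
    then show ?thesis
      using comb[of "{..<m}" d] by simp
  qed
  then have "V.span ?C = carrier ?V"
    using V.span_is_subset2[OF C] by blast
  then have "rank_over R X = V.dim"
    by (simp add: rank_over_def Let_def dims)
  then show ?thesis
    using dim_func_space[of "{..<n}"] by (simp add: R_def)
qed

section \<open>Random matrices with min-entropy\<close>

lemma mats_over_eqI:
  assumes "X \<in> mats_over R n m" "Y \<in> mats_over R n m"
    and "\<And>ij. ij \<in> {..<n} \<times> {..<m} \<Longrightarrow> X $$ ij = Y $$ ij"
  shows "X = Y"
  using assms by (intro eq_matI) (auto simp: mats_over_def)

lemma finite_mats_over:
  assumes "finite (carrier R)"
  shows "finite (mats_over R n m)"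
proof (rule inj_on_finite)
  let ?U = "{..<n} \<times> {..<m}"
  let ?f = "\<lambda>X. restrict (($$) X) ?U"
  show "inj_on ?f (mats_over R n m)"
  proof (rule inj_onI)
    fix X Y assume XY: "X \<in> mats_over R n m" "Y \<in> mats_over R n m" "?f X = ?f Y"
    have "X $$ ij = Y $$ ij" if "ij \<in> ?U" for ij
      using fun_cong[OF XY(3), of ij] that by simp
    with XY show "X = Y" using mats_over_eqI by blast
  qed
  show "?f ` mats_over R n m \<subseteq> ?U \<rightarrow>\<^sub>E carrier R"
    using mats_over_entry by (intro image_subsetI restrict_PiE_iff[THEN iffD2]) blast
  show "finite (?U \<rightarrow>\<^sub>E carrier R)"
    using assms by (intro finite_PiE) auto
qed

locale min_entropy_matrix =
  fixes p n m :: nat and A :: "int mat pmf" and \<beta> :: real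
  assumes prime_p: "prime p" and n_pos: "0 < n" and n_le_m: "n \<le> m"
    and random: "random_matrix p n m A"
    and entropy: "min_entropy_ge p n m A \<beta>"
begin

abbreviation mats :: "int mat set" where
  "mats \<equiv> mats_over (residue_ring (int p)) n m"

abbreviation indices :: "(nat \<times> nat) set" where
  "indices \<equiv> {..<n} \<times> {..<m}"

text \<open>The fiber through \<open>X\<close> of the map that forgets the entries in
  \<open>S\<close>: the conditioning event when everything outside \<open>S\<close> has been
  revealed.\<close>

definition fiber :: "(nat \<times> nat) set \<Rightarrow> int mat \<Rightarrow> int mat set" where
  "fiber S X = {Z \<in> mats. \<forall>ij\<in>indices - S. Z $$ ij = X $$ ij}"

definition indep_mats :: "nat \<Rightarrow> int mat set" where
  "indep_mats k = {X \<in> mats. rows_indep (int p) k m (\<lambda>i j. X $$ (i, j))}"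

lemma finite_mats: "finite mats"
  by (intro finite_mats_over) (simp add: residue_ring_def)

lemma set_pmf_subset: "set_pmf A \<subseteq> mats"
  using random by (simp add: random_matrix_def)

lemma prob_restrict: "measure_pmf.prob A {X. P X} = measure_pmf.prob A {X \<in> mats. P X}"
  using set_pmf_subset by (intro measure_prob_cong_0) (auto simp: set_pmf_iff)

lemma finite_fiber: "finite (fiber S X)"
  using finite_mats by (rule finite_subset[rotated]) (auto simp: fiber_def)

text \<open>Min-entropy of \<open>e\<close>, with the other entries fixed as in \<open>X\<close>,
  multiplied out. If the conditioning event is null, so is \<open>X\<close>.\<close>

lemma pmf_le_fiber_singleton:
  assumes X: "X \<in> mats" and e: "e \<in> indices"
  shows "pmf A X \<le> (1 - \<beta>) * measure_pmf.prob A (fiber {e} X)"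
proof -
  let ?agree = "\<lambda>Z. \<forall>ij\<in>indices - {e}. Z $$ ij = X $$ ij"
  have agree: "measure_pmf.prob A {Z. ?agree Z} = measure_pmf.prob A (fiber {e} X)"
    unfolding fiber_def by (rule prob_restrict)
  show ?thesis
  proof (cases "measure_pmf.prob A {Z. ?agree Z} = 0")
    case True
    have "pmf A X \<le> measure_pmf.prob A {Z. ?agree Z}"
      unfolding pmf.rep_eq by (intro measure_pmf.finite_measure_mono) auto
    then show ?thesis
      using True agree by simp
  next
    case False
    have "entry_min_entropy_ge p A \<beta> (indices - {e}) e"
      using entropy e unfolding min_entropy_ge_def by blast
    then have "\<P>(Z in A. Z $$ e = X $$ e \<bar> ?agree Z) \<le> 1 - \<beta>"
      unfolding entry_min_entropy_ge_def
      using False mats_over_entry[OF X] e by (elim ballE[of _ _ "($$) X"]) auto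
    then have "measure_pmf.prob A {Z. Z $$ e = X $$ e \<and> ?agree Z}
        \<le> (1 - \<beta>) * measure_pmf.prob A {Z. ?agree Z}"
      using False by (simp add: cond_prob_def divide_le_eq zero_less_measure_iff)
    moreover have "pmf A X \<le> measure_pmf.prob A {Z. Z $$ e = X $$ e \<and> ?agree Z}"
      unfolding pmf.rep_eq by (intro measure_pmf.finite_measure_mono) auto
    ultimately show ?thesis
      using agree by simp
  qed
qed

text \<open>Some matrix has positive mass, and the matrix has an entry \<open>(0, 0)\<close>; the
  bound for this entry forces \<open>1 - \<beta>\<close> to be positive.\<close>

lemma beta_less_1: "\<beta> < 1"
proof -
  obtain X where X: "X \<in> set_pmf A"
    using set_pmf_not_empty by fast
  have "0 < pmf A X"
    using X by (simp add: pmf_positive)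
  also have "\<dots> \<le> (1 - \<beta>) * measure_pmf.prob A (fiber {(0, 0)} X)"
    using X set_pmf_subset n_pos n_le_m by (intro pmf_le_fiber_singleton) auto
  finally show ?thesis
    using measure_nonneg[of A "fiber {(0, 0)} X"] by (auto simp: zero_less_mult_iff)
qed

text \<open>A chain rule. Freeing \<open>e\<close> costs one factor \<open>1 - \<beta>\<close>, and
  the induction hypothesis applies to every matrix in the resulting fiber. Their fibers over
  \<open>S\<close> are disjoint, because these matrices differ at \<open>e\<close>, which is outside
  \<open>S\<close>, and all lie in the fiber over \<open>insert e S\<close>.\<close>

lemma pmf_le_fiber:
  assumes "finite S" "S \<subseteq> indices" "X \<in> mats"
  shows "pmf A X \<le> (1 - \<beta>) ^ card S * measure_pmf.prob A (fiber S X)"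
  using assms
proof (induction S arbitrary: X rule: finite_induct)
  case empty
  have "X \<in> fiber {} X"
    using empty by (simp add: fiber_def)
  then show ?case
    unfolding pmf.rep_eq by (auto intro!: measure_pmf.finite_measure_mono)
next
  case (insert e S)
  have q: "0 \<le> 1 - \<beta>" using beta_less_1 by simp
  have disj: "disjoint_family_on (fiber S) (fiber {e} X)"
    unfolding disjoint_family_on_def
  proof (intro ballI impI, rule ccontr)
    fix Y Z assume Y: "Y \<in> fiber {e} X" and Z: "Z \<in> fiber {e} X" and "Y \<noteq> Z"
      and "fiber S Y \<inter> fiber S Z \<noteq> {}"
    then obtain W where W: "W \<in> fiber S Y" "W \<in> fiber S Z" by blast
    have "Y $$ ij = Z $$ ij" if "ij \<in> indices" for ij
      using that Y Z W insert.hyps unfolding fiber_def by (cases "ij = e") auto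
    then have "Y = Z"
      using Y Z by (intro mats_over_eqI[of Y _ n m Z]) (auto simp: fiber_def)
    with \<open>Y \<noteq> Z\<close> show False by blast
  qed
  have "pmf A X \<le> (1 - \<beta>) * measure_pmf.prob A (fiber {e} X)"
    using insert.prems by (intro pmf_le_fiber_singleton) auto
  also have "measure_pmf.prob A (fiber {e} X) = (\<Sum>Z\<in>fiber {e} X. pmf A Z)"
    by (rule measure_measure_pmf_finite[OF finite_fiber])
  also have "\<dots> \<le> (\<Sum>Z\<in>fiber {e} X. (1 - \<beta>) ^ card S * measure_pmf.prob A (fiber S Z))"
    using insert.prems by (intro sum_mono insert.IH) (auto simp: fiber_def)
  also have "\<dots> = (1 - \<beta>) ^ card S * measure_pmf.prob A (\<Union>Z\<in>fiber {e} X. fiber S Z)"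
    using disj finite_fiber
    by (subst measure_pmf.finite_measure_finite_Union) (auto simp: sum_distrib_left)
  also have "measure_pmf.prob A (\<Union>Z\<in>fiber {e} X. fiber S Z) \<le> measure_pmf.prob A (fiber (insert e S) X)"
    by (intro measure_pmf.finite_measure_mono) (auto simp: fiber_def)
  finally show ?case
    using q insert.hyps by (simp add: mult_left_mono mult.assoc)
qed

text \<open>
  If row \<open>k\<close> lies in the span of the rows above it, then it is determined by its entries in at
  most \<open>k\<close> pivot columns of these rows, so the fibers over the remaining \<open>\<ge> m - k\<close> entries of
  row \<open>k\<close> are disjoint for distinct such matrices.
\<close>

lemma prob_indep_mats_Suc:
  assumes "0 \<le> \<beta>" "k < n"
  shows "(1 - (1 - \<beta>) ^ (m - k)) * measure_pmf.prob A (indep_mats k)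
    \<le> measure_pmf.prob A (indep_mats (Suc k))"
proof -
  define B where "B = indep_mats k - indep_mats (Suc k)"
  \<comment> \<open>The default 0 makes \<open>rows X\<close> a function of the first
    \<open>k\<close> rows alone. Matrices sharing these rows thus get the same pivot set
    \<open>J (rows X)\<close> and the same \<open>S X\<close>.\<close>
  define rows where "rows X = (\<lambda>i j. if i < k \<and> j < m then X $$ (i, j) else (0::int))" for X :: "int mat"
  have rows_sum: "(\<Sum>i<k. c i * rows X i j) = (\<Sum>i<k. c i * X $$ (i, j))" if "j < m" for c X j
    using that by (simp add: rows_def)
  have "\<forall>x. \<exists>J. J \<subseteq> {..<m} \<and> card J \<le> k \<and>
    (\<forall>c. (\<forall>j\<in>J. int p dvd (\<Sum>i<k. c i * x i j)) \<longrightarrow> (\<forall>j<m. int p dvd (\<Sum>i<k. c i * x i j)))"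
    using pivot_columns[of "int p" m k] prime_p by auto
  from choice[OF this] obtain J where J_all: "\<forall>x. J x \<subseteq> {..<m} \<and> card (J x) \<le> k \<and>
    (\<forall>c. (\<forall>j\<in>J x. int p dvd (\<Sum>i<k. c i * x i j)) \<longrightarrow> (\<forall>j<m. int p dvd (\<Sum>i<k. c i * x i j)))" ..
  have J: "J x \<subseteq> {..<m}" "card (J x) \<le> k"
    "(\<forall>j\<in>J x. int p dvd (\<Sum>i<k. c i * x i j)) \<Longrightarrow> j < m \<Longrightarrow> int p dvd (\<Sum>i<k. c i * x i j)"
    for x c j
    using J_all[rule_format, of x] by simp_all
  define S where "S X = {k} \<times> ({..<m} - J (rows X))" for X
  have S_sub: "S X \<subseteq> indices" for X
    using assms by (auto simp: S_def)
  have finS: "finite (S X)" for X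
    by (simp add: S_def)
  have card_S: "m - k \<le> card (S X)" for X
  proof -
    have "card (S X) = m - card (J (rows X))"
      using J(1)[of "rows X"] by (simp add: S_def card_cartesian_product card_Diff_subset finite_subset)
    then show ?thesis
      using J(2)[of "rows X"] by simp
  qed
  \<comment> \<open>\<open>S X\<close> lies within row \<open>k\<close>, so moving inside the fiber
    leaves the rows above unchanged.\<close>
  have rows_fiber: "rows Z = rows X" if "Z \<in> fiber (S X) X" for X Z
    using that assms(2) unfolding rows_def fiber_def S_def by (auto simp: fun_eq_iff)
  have indep_rows: "X \<in> indep_mats k \<longleftrightarrow> X \<in> mats \<and> rows_indep (int p) k m (rows X)" for X
    using rows_sum by (simp add: indep_mats_def rows_indep_def)
  have fiber_indep: "fiber (S X) X \<subseteq> indep_mats k" if "X \<in> B" for X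
    using that rows_fiber unfolding B_def indep_rows by (auto simp: indep_rows fiber_def)
  have B_mats: "X \<in> mats" if "X \<in> B" for X
    using that by (auto simp: B_def indep_mats_def)
  have finB: "finite B"
    using finite_mats B_mats by (meson finite_subset subsetI)
  have disj: "disjoint_family_on (\<lambda>X. fiber (S X) X) B"
    unfolding disjoint_family_on_def
  proof (intro ballI impI, rule ccontr)
    fix X Y assume X: "X \<in> B" and Y: "Y \<in> B" and neq: "X \<noteq> Y"
      and "fiber (S X) X \<inter> fiber (S Y) Y \<noteq> {}"
    then obtain Z where Z: "Z \<in> fiber (S X) X" "Z \<in> fiber (S Y) Y" by blast
    have rows_eq: "rows X = rows Y"
      using rows_fiber[OF Z(1)] rows_fiber[OF Z(2)] by simp
    then have S_eq: "S X = S Y"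
      by (simp add: S_def)
    have off_S: "X $$ ij = Y $$ ij" if "ij \<in> indices - S X" for ij
      using Z that S_eq by (auto simp: fiber_def)
    have span: "\<exists>c. \<forall>j<m. [W $$ (k, j) = (\<Sum>i<k. c i * rows W i j)] (mod int p)" if "W \<in> B" for W
      using that row_in_span_if_not_indep[of "int p" k m "\<lambda>i j. W $$ (i, j)"] prime_p rows_sum
      by (auto simp: B_def indep_mats_def)
    obtain c where c: "\<And>j. j < m \<Longrightarrow> [X $$ (k, j) = (\<Sum>i<k. c i * rows X i j)] (mod int p)"
      using span[OF X] by blast
    obtain d where d: "\<And>j. j < m \<Longrightarrow> [Y $$ (k, j) = (\<Sum>i<k. d i * rows X i j)] (mod int p)"
      using span[OF Y] rows_eq by auto
    \<comment> \<open>The difference of the two \<open>k\<close>-th rows lies in the span of the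
      common rows above. It vanishes on the pivot columns, where \<open>X\<close> and
      \<open>Y\<close> agree, hence vanishes mod \<open>p\<close> everywhere.\<close>
    have diff: "[X $$ (k, j) - Y $$ (k, j) = (\<Sum>i<k. (c i - d i) * rows X i j)] (mod int p)"
      if "j < m" for j
      using cong_diff[OF c[OF that] d[OF that]] by (simp add: left_diff_distrib sum_subtractf)
    have "int p dvd (\<Sum>i<k. (c i - d i) * rows X i j)" if "j \<in> J (rows X)" for j
    proof -
      have "j < m" using that J(1) by blast
      then have "X $$ (k, j) = Y $$ (k, j)"
        using that off_S[of "(k, j)"] assms(2) by (auto simp: S_def)
      then show ?thesis
        using cong_dvd_iff[OF diff[OF \<open>j < m\<close>]] by simp
    qed
    then have "int p dvd (\<Sum>i<k. (c i - d i) * rows X i j)" if "j < m" for j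
      using J(3)[of "rows X" "\<lambda>i. c i - d i" j] that by blast
    then have row_k: "[X $$ (k, j) = Y $$ (k, j)] (mod int p)" if "j < m" for j
      using cong_dvd_iff[OF diff[OF that]] that by (simp add: cong_iff_dvd_diff)
    have "X $$ ij = Y $$ ij" if ij: "ij \<in> indices" for ij
    proof (cases "ij \<in> S X")
      case True
      then obtain j where "ij = (k, j)" "j < m" by (auto simp: S_def)
      moreover have "X $$ ij \<in> {0..int p - 1}" "Y $$ ij \<in> {0..int p - 1}"
        using mats_over_entry[OF B_mats[OF X] ij] mats_over_entry[OF B_mats[OF Y] ij]
        by (simp_all add: residue_ring_def)
      ultimately show ?thesis
        using row_k[of j] by (simp add: cong_def)
    next
      case False
      then show ?thesis using off_S ij by blast
    qed
    then have "X = Y"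
      using mats_over_eqI[OF B_mats[OF X] B_mats[OF Y]] by blast
    with neq show False by blast
  qed
  have q: "0 \<le> 1 - \<beta>" "1 - \<beta> \<le> 1"
    using beta_less_1 assms by auto
  \<comment> \<open>Each \<open>X\<close> in \<open>B\<close> is charged to its fiber; these fibers
    are disjoint and contained in \<open>indep_mats k\<close>.\<close>
  have "measure_pmf.prob A B = (\<Sum>X\<in>B. pmf A X)"
    by (rule measure_measure_pmf_finite[OF finB])
  also have "\<dots> \<le> (\<Sum>X\<in>B. (1 - \<beta>) ^ (m - k) * measure_pmf.prob A (fiber (S X) X))"
  proof (rule sum_mono)
    fix X assume "X \<in> B"
    then have "pmf A X \<le> (1 - \<beta>) ^ card (S X) * measure_pmf.prob A (fiber (S X) X)"
      using finS S_sub B_mats by (intro pmf_le_fiber)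
    also have "\<dots> \<le> (1 - \<beta>) ^ (m - k) * measure_pmf.prob A (fiber (S X) X)"
      using q card_S by (intro mult_right_mono power_decreasing) auto
    finally show "pmf A X \<le> (1 - \<beta>) ^ (m - k) * measure_pmf.prob A (fiber (S X) X)" .
  qed
  also have "\<dots> = (1 - \<beta>) ^ (m - k) * measure_pmf.prob A (\<Union>X\<in>B. fiber (S X) X)"
    using disj finB
    by (subst measure_pmf.finite_measure_finite_Union) (auto simp: sum_distrib_left)
  also have "\<dots> \<le> (1 - \<beta>) ^ (m - k) * measure_pmf.prob A (indep_mats k)"
    using q fiber_indep by (intro mult_left_mono measure_pmf.finite_measure_mono) auto
  finally have "measure_pmf.prob A B \<le> (1 - \<beta>) ^ (m - k) * measure_pmf.prob A (indep_mats k)" .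
  moreover have "measure_pmf.prob A (indep_mats k)
      \<le> measure_pmf.prob A (B \<union> indep_mats (Suc k))"
    by (intro measure_pmf.finite_measure_mono) (auto simp: B_def)
  moreover have "measure_pmf.prob A (B \<union> indep_mats (Suc k))
      \<le> measure_pmf.prob A B + measure_pmf.prob A (indep_mats (Suc k))"
    by (intro measure_Un_le) auto
  ultimately show ?thesis
    by (simp add: left_diff_distrib)
qed

lemma prob_indep_mats_ge:
  assumes "0 \<le> \<beta>" "k \<le> n"
  shows "(\<Prod>i<k. 1 - (1 - \<beta>) ^ (m - i)) \<le> measure_pmf.prob A (indep_mats k)"
  using assms(2)
proof (induction k)
  case 0
  have "measure_pmf.prob A mats = 1"
    using set_pmf_subset by (subst measure_pmf.prob_eq_1) (auto simp: AE_measure_pmf_iff)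
  then show ?case by (simp add: indep_mats_def rows_indep_def)
next
  case (Suc k)
  have "0 \<le> 1 - (1 - \<beta>) ^ (m - k)"
    using beta_less_1 assms(1) by (simp add: power_le_one)
  then have "(\<Prod>i<Suc k. 1 - (1 - \<beta>) ^ (m - i))
      \<le> (1 - (1 - \<beta>) ^ (m - k)) * measure_pmf.prob A (indep_mats k)"
    using Suc by (subst prod.lessThan_Suc, subst mult.commute, intro mult_left_mono) auto
  also have "\<dots> \<le> measure_pmf.prob A (indep_mats (Suc k))"
    using assms(1) Suc.prems by (intro prob_indep_mats_Suc) auto
  finally show ?case .
qed

lemma prob_full_rank_ge:
  assumes "0 \<le> \<beta>"
  shows "(\<Prod>i<n. 1 - (1 - \<beta>) ^ (m - i)) \<le> \<P>(X in A. rank_over (residue_ring (int p)) X = n)"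
proof -
  have "measure_pmf.prob A (indep_mats n) \<le> measure_pmf.prob A {X. rank_over (residue_ring (int p)) X = n}"
    using rank_over_eq_if_rows_indep[OF prime_p]
    by (intro measure_pmf.finite_measure_mono) (auto simp: indep_mats_def)
  then show ?thesis
    using prob_indep_mats_ge[OF assms order.refl] by simp
qed

end

section \<open>The product bound\<close>

text \<open>The row factors in reverse order: with \<open>d = m - n\<close> the last row contributes
  the exponent \<open>d + 1\<close>. Estimates uniform in \<open>n\<close> then depend on the excess
  \<open>d\<close> only.\<close>

definition qprod :: "real \<Rightarrow> nat \<Rightarrow> nat \<Rightarrow> real" where
  "qprod q d n = (\<Prod>i<n. 1 - q ^ (d + 1 + i))"

lemma qprod_reindex:
  assumes "n \<le> m"
  shows "(\<Prod>i<n. 1 - q ^ (m - i)) = qprod q (m - n) n"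
proof -
  have "(\<Prod>i<n. 1 - q ^ (m - i)) = (\<Prod>i<n. 1 - q ^ (m - (n - Suc i)))"
    by (rule prod.nat_diff_reindex[symmetric])
  also have "\<dots> = qprod q (m - n) n"
    unfolding qprod_def using assms by (intro prod.cong refl arg_cong[of _ _ "\<lambda>k. 1 - q ^ k"]) auto
  finally show ?thesis .
qed

context
  fixes q :: real
  assumes q: "0 < q" "q < 1"
begin

lemma q_power_le_1: "q * q ^ k \<le> 1"
  using q power_le_one[of q "Suc k"] by simp

lemma qprod_nonneg: "0 \<le> qprod q d n"
  unfolding qprod_def using q_power_le_1 by (intro prod_nonneg) simp

lemma qprod_le_1: "qprod q d n \<le> 1"
  unfolding qprod_def using q q_power_le_1 by (intro prod_le_1) simp

text \<open>The Weierstrass product inequality followed by the geometric series.\<close>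

lemma qprod_ge: "1 - q ^ (d + 1) / (1 - q) \<le> qprod q d n"
proof -
  have "(\<Sum>i<n. q ^ (d + 1 + i)) = q ^ (d + 1) * (\<Sum>i<n. q ^ i)"
    by (simp add: power_add sum_distrib_left mult.assoc)
  also have "\<dots> = q ^ (d + 1) * ((1 - q ^ n) / (1 - q))"
    using q by (simp add: sum_gp_strict)
  also have "\<dots> \<le> q ^ (d + 1) * (1 / (1 - q))"
    using q by (intro mult_left_mono divide_right_mono) auto
  finally have "1 - q ^ (d + 1) / (1 - q) \<le> 1 - (\<Sum>i<n. q ^ (d + 1 + i))"
    by simp
  also have "\<dots> \<le> qprod q d n"
    unfolding qprod_def using q q_power_le_1 by (intro Weierstrass_prod_ineq) simp
  finally show ?thesis .
qed

lemma qprod_add: "qprod q d (L + n) = qprod q d L * qprod q (d + L) n"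
  by (induction n) (simp_all add: qprod_def add.assoc)

text \<open>For small \<open>d\<close> the bound \<open>qprod_ge\<close> may be negative. Here
  \<open>L\<close> is so large that the factors after the first \<open>L\<close> have product at
  least 1/2, while each of the first \<open>L\<close> is at least \<open>1 - q\<close>.\<close>

lemma qprod_ge_const: "\<exists>c. 0 < c \<and> c < 1 \<and> (\<forall>d n. c \<le> qprod q d n)"
proof -
  obtain L where L: "q ^ L < (1 - q) / 2"
    using real_arch_pow_inv[of "(1 - q) / 2" q] q by auto
  then have "q ^ (L + 1) / (1 - q) \<le> 1 / 2"
    using q mult_mono[of q 1 "q ^ L" "(1 - q) / 2"] by (simp add: field_simps)
  then have half: "1 / 2 \<le> qprod q L n" for n
    using qprod_ge[of L n] by simp
  have L_le: "(1 - q) ^ L \<le> qprod q 0 L"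
  proof -
    have "(\<Prod>i<L. 1 - q) \<le> qprod q 0 L"
      unfolding qprod_def using q by (intro prod_mono) (auto simp: mult_left_le power_le_one)
    then show ?thesis by simp
  qed
  have "(1 - q) ^ L * (1 / 2) \<le> qprod q d n" for d n
  proof -
    have "(1 - q) ^ L * (1 / 2) \<le> qprod q 0 L * qprod q L n"
      using half[of n] L_le q by (intro mult_mono) (auto simp: qprod_nonneg)
    \<comment> \<open>Splitting the same \<open>L + n\<close> factors after \<open>n\<close> instead
      leaves \<open>L\<close> surplus factors, each at most 1; this also covers
      \<open>n < L\<close>.\<close>
    also have "\<dots> = qprod q 0 n * qprod q n L"
      using qprod_add[of 0 L n] qprod_add[of 0 n L] by (simp add: add.commute)
    also have "\<dots> \<le> qprod q 0 n * 1"
      by (intro mult_left_mono qprod_le_1 qprod_nonneg)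
    also have "\<dots> \<le> qprod q d n"
      unfolding qprod_def using q
      by (simp, intro prod_mono conjI) (auto intro!: power_decreasing mult_left_mono simp: q_power_le_1)
    finally show ?thesis .
  qed
  moreover have "(1 - q) ^ L \<le> 1"
    using q by (intro power_le_one) auto
  ultimately show ?thesis
    using q by (intro exI[of _ "(1 - q) ^ L * (1 / 2)"]) auto
qed

text \<open>With \<open>s = sqrt q\<close>, the error in \<open>qprod_ge\<close> is
  \<open>s ^ (2 * d)\<close> times a constant. For large \<open>d\<close> one factor
  \<open>s ^ d\<close> absorbs the constant and the other gives the decay; the remaining
  \<open>d\<close> are handled by the uniform bound \<open>c\<close>.\<close>

lemma qprod_ge_exp: "\<exists>K>0. \<forall>d n. 1 - exp (- K * real d) \<le> qprod q d n"
proof -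
  obtain c where c: "0 < c" "c < 1" "\<And>d n. c \<le> qprod q d n"
    using qprod_ge_const by blast
  define s where "s = sqrt q"
  have s: "0 < s" "s < 1" "s * s = q"
    using q by (auto simp: s_def)
  obtain N0 where N0: "s ^ N0 < (1 - q) / q"
    using real_arch_pow_inv[of "(1 - q) / q" s] q s by auto
  \<comment> \<open>The successor keeps \<open>N\<close> positive, so that dividing by
    \<open>real N\<close> in \<open>K\<close> is harmless.\<close>
  define N where "N = Suc N0"
  \<comment> \<open>The first term ensures \<open>s ^ d \<le> exp (- K * d)\<close>, the second
    \<open>1 - c \<le> exp (- K * d)\<close> for \<open>d < N\<close>.\<close>
  define K where "K = min (- ln s) (- ln (1 - c) / real N)"
  have "0 < K"
    using s c by (auto simp: K_def N_def divide_neg_pos)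
  moreover have "1 - exp (- K * real d) \<le> qprod q d n" for d n
  proof (cases "d < N")
    case True
    have "K * real d \<le> - ln (1 - c) / real N * real N"
      using True \<open>0 < K\<close> c by (intro mult_mono) (auto simp: K_def divide_nonneg_nonneg divide_nonpos_nonneg)
    also have "\<dots> = - ln (1 - c)"
      by (simp add: N_def)
    finally have "exp (ln (1 - c)) \<le> exp (- K * real d)"
      by simp
    then show ?thesis
      using c(3)[of d n] c(2) by simp
  next
    case False
    have "s ^ d \<le> s ^ N0"
      using False s by (intro power_decreasing) (auto simp: N_def)
    with N0 have "s ^ d \<le> (1 - q) / q" by simp
    then have sd: "s ^ d * q / (1 - q) \<le> 1"
      using q by (simp add: field_simps)
    have "q ^ (d + 1) / (1 - q) = s ^ d * (s ^ d * q / (1 - q))"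
      by (simp flip: s(3) add: power_mult_distrib)
    also have "\<dots> \<le> s ^ d * 1"
      using sd s by (intro mult_left_mono) auto
    also have "\<dots> = exp (real d * ln s)"
      using s by (simp add: exp_of_nat_mult)
    also have "\<dots> \<le> exp (- K * real d)"
      using mult_right_mono[of K "- ln s" "real d"] by (simp add: K_def mult.commute)
    finally show ?thesis
      using qprod_ge[of d n] by simp
  qed
  ultimately show ?thesis by blast
qed

end

section \<open>The two probability bounds from the product estimates with
  \<open>q = 1 - \<beta>\<close>\<close>

theorem theorem4p2:
  fixes \<beta> :: real
  assumes "\<beta> > 0"
  shows
    "(\<forall>p n m A.
        prime p \<and> 0 < n \<and> n \<le> m \<and> random_matrix p n m A \<and> min_entropy_ge p n m A \<beta> \<longrightarrow>
        \<P>(X in A. rank_over (residue_ring (int p)) X = n)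
          \<ge> 1 - 1 / \<beta>\<^sup>2 * (1 - \<beta>) ^ (m + 1 - n)) \<and>
     (\<exists>K>0. \<forall>p n m A.
        prime p \<and> 0 < n \<and> n \<le> m \<and> random_matrix p n m A \<and> min_entropy_ge p n m A \<beta> \<longrightarrow>
        \<P>(X in A. rank_over (residue_ring (int p)) X = n)
          \<ge> 1 - exp (- K * (real m - real n)))"
proof -
  have main: "qprod (1 - \<beta>) (m - n) n \<le> \<P>(X in A. rank_over (residue_ring (int p)) X = n)
      \<and> \<beta> < 1 \<and> n \<le> m"
    if "prime p \<and> 0 < n \<and> n \<le> m \<and> random_matrix p n m A \<and> min_entropy_ge p n m A \<beta>" for p n m A
  proof -
    interpret min_entropy_matrix p n m A \<beta>
      using that by unfold_locales auto
    show ?thesis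
      using prob_full_rank_ge assms beta_less_1 n_le_m by (simp add: qprod_reindex)
  qed
  show ?thesis
  proof (intro conjI allI impI)
    fix p n m A
    assume "prime p \<and> 0 < n \<and> n \<le> m \<and> random_matrix p n m A \<and> min_entropy_ge p n m A \<beta>"
    note * = main[OF this]
    then have d: "m - n + 1 = m + 1 - n" by linarith
    \<comment> \<open>The product estimate has the constant \<open>1 / \<beta>\<close>, which
      \<open>\<beta> < 1\<close> allows to be weakened to the stated one.\<close>
    have "1 / \<beta> \<le> 1 / \<beta>\<^sup>2"
      using * assms by (simp add: field_simps power2_eq_square)
    then have "(1 - \<beta>) ^ (m + 1 - n) / \<beta> \<le> 1 / \<beta>\<^sup>2 * (1 - \<beta>) ^ (m + 1 - n)"
      using * mult_right_mono[of "1 / \<beta>" "1 / \<beta>\<^sup>2" "(1 - \<beta>) ^ (m + 1 - n)"] by simp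
    then show "1 - 1 / \<beta>\<^sup>2 * (1 - \<beta>) ^ (m + 1 - n)
        \<le> \<P>(X in A. rank_over (residue_ring (int p)) X = n)"
      using qprod_ge[of "1 - \<beta>" "m - n" n] * assms unfolding d by simp
  next
    show "\<exists>K>0. \<forall>p n m A.
        prime p \<and> 0 < n \<and> n \<le> m \<and> random_matrix p n m A \<and> min_entropy_ge p n m A \<beta> \<longrightarrow>
        \<P>(X in A. rank_over (residue_ring (int p)) X = n) \<ge> 1 - exp (- K * (real m - real n))"
    proof (cases "\<beta> < 1")
      case True
      then obtain K where K: "K > 0" "\<And>d n. 1 - exp (- K * real d) \<le> qprod (1 - \<beta>) d n"
        using qprod_ge_exp[of "1 - \<beta>"] assms by auto
      show ?thesis
      proof (intro exI[of _ K] conjI allI impI)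
        fix p n m A
        assume "prime p \<and> 0 < n \<and> n \<le> m \<and> random_matrix p n m A \<and> min_entropy_ge p n m A \<beta>"
        note * = main[OF this]
        then show "1 - exp (- K * (real m - real n))
            \<le> \<P>(X in A. rank_over (residue_ring (int p)) X = n)"
          using K(2)[of "m - n" n] by (simp add: of_nat_diff)
      qed (rule K(1))
    next
      case False
      \<comment> \<open>By \<open>main\<close> no matrix satisfies the hypotheses when
        \<open>\<beta> \<ge> 1\<close>, so any positive \<open>K\<close> will do.\<close>
      then show ?thesis
        using main by (intro exI[of _ 1]) fastforce
    qed
  qed
qed

end
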